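(* For each positive integer $n$, let $\mathcal{D}_n^{\mathsf{Pop}}$ be the average number of iterations of $\mathsf{Pop}$ that it takes to transform a uniformly randomly chosen permutation of length $n$ into the identity permutation $12\cdots n$. Then $$\liminf_{n \rightarrow \infty} \frac{\mathcal{D}_n^{\mathsf{Pop}}}{n} \geq \frac{3}{5}.$$
   Context: A permutation of length $n$ is an ordered list (one-line notation) $\sigma(1)\sigma(2)\cdots\sigma(n)$ of the elements of $\{1,\dots,n\}$, each appearing exactly once. The map $\mathsf{Pop}$ from permutations of length $n$ to permutations of length $n$ reverses, in place and simultaneously, every maximal block of consecutive entries that is decreasing; for example, $\mathsf{Pop}(471836952)=417386259$ (the blocks $71$, $83$, $952$ are reversed). The number of iterations that $\mathsf{Pop}$ takes to transform $\sigma$ into the identity is the least $t\ge 0$ such that $\mathsf{Pop}^t(\sigma)=12\cdots n$ (it is known that such a $t$ always exists); $\mathcal{D}_n^{\mathsf{Pop}}$ is the average of this quantity over all $n!$ permutations $\sigma$ of length $n$. *)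

theory Defs
  imports Complex_Main "HOL-Library.Extended_Real" "HOL-Combinatorics.Multiset_Permutations"
begin

text \<open>
  A permutation of length \<open>n\<close> is its one-line notation, i.e. an element of
  \<^term>\<open>permutations_of_set {1..n::nat}\<close>.
\<close>

fun desc_runs :: "'a::linorder list \<Rightarrow> 'a list list" where
  "desc_runs [] = []"
| "desc_runs (x # xs) =
     (case desc_runs xs of
        [] \<Rightarrow> [[x]]
      | r # rs \<Rightarrow> if x > hd r then (x # r) # rs else [x] # r # rs)"

lemma concat_desc_runs: "concat (desc_runs xs) = xs"
  by (induction xs) (auto split: list.splits if_splits)

lemma desc_runs_nonempty: "r \<in> set (desc_runs xs) \<Longrightarrow> r \<noteq> []"
  by (induction xs arbitrary: r) (auto split: list.splits if_splits)

lemma hd_hd_desc_runs: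
  assumes "xs \<noteq> []"
  shows "desc_runs xs \<noteq> []" "hd (hd (desc_runs xs)) = hd xs"
  using assms by (cases xs; auto split: list.splits if_splits)+

lemma desc_runs_decreasing: "r \<in> set (desc_runs xs) \<Longrightarrow> successively (>) r"
proof (induction xs arbitrary: r)
  case (Cons x xs)
  have "r \<noteq> []" if "r \<in> set (desc_runs xs)" for r
    using that by (rule desc_runs_nonempty)
  then show ?case
    using Cons by (auto simp: successively_Cons split: list.splits if_splits)
qed simp

lemma desc_runs_maximal: "successively (\<lambda>r s. last r \<le> hd s) (desc_runs xs)"
proof (induction xs)
  case (Cons x xs)
  have "r \<noteq> []" if "r \<in> set (desc_runs xs)" for r
    using that by (rule desc_runs_nonempty)
  then show ?case
    using Cons by (auto simp: successively_Cons split: list.splits if_splits)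
qed simp

lemma desc_runs_append:
  assumes "r \<noteq> []" "successively (>) r" "ys = [] \<or> last r \<le> hd ys"
  shows "desc_runs (r @ ys) = r # desc_runs ys"
  using assms
proof (induction r)
  case (Cons x r)
  show ?case
  proof (cases "r = []")
    case True
    then show ?thesis
      using Cons.prems hd_hd_desc_runs[of ys]
      by (cases "ys = []") (auto split: list.splits)
  next
    case False
    then show ?thesis
      using Cons by (auto simp: successively_Cons split: list.splits)
  qed
qed simp

text \<open>
  The decomposition into maximal decreasing blocks is the unique list of blocks
  satisfying the following four assumptions.
\<close>

lemma desc_runs_unique:
  assumes "concat rs = xs" "\<And>r. r \<in> set rs \<Longrightarrow> r \<noteq> []"
    "\<And>r. r \<in> set rs \<Longrightarrow> successively (>) r"
    "successively (\<lambda>r s. last r \<le> hd s) rs"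
  shows "rs = desc_runs xs"
  using assms
proof (induction rs arbitrary: xs)
  case (Cons r rs)
  have "rs = desc_runs (concat rs)"
    using Cons by (auto simp: successively_Cons)
  moreover have "concat rs = [] \<or> last r \<le> hd (concat rs)"
    using Cons.prems by (cases rs) (auto simp: successively_Cons)
  then have "desc_runs (r @ concat rs) = r # desc_runs (concat rs)"
    using Cons.prems by (intro desc_runs_append) auto
  ultimately show ?case
    using Cons.prems(1) by simp
qed simp

definition Pop :: "'a::linorder list \<Rightarrow> 'a list" where
  "Pop xs = concat (map rev (desc_runs xs))"

lemma "Pop [4,7,1,8,3,6,9,5,2] = [4,1,7,3,8,6,2,5,9::nat]"
  by (simp add: Pop_def)

definition pop_iterations :: "nat list \<Rightarrow> nat" where
  "pop_iterations \<sigma> = (LEAST t. (Pop ^^ t) \<sigma> = [1..<Suc (length \<sigma>)])"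

definition D_Pop :: "nat \<Rightarrow> real" where
  "D_Pop n = (\<Sum>\<sigma>\<in>permutations_of_set {1..n}. real (pop_iterations \<sigma>)) / fact n"

end

theory Submission
  imports Defs
begin

text \<open>
  Let \<open>A\<^sub>t\<close> be the descent set after \<open>t\<close> steps. It is disjoint from \<open>A\<^sub>t\<^sub>+\<^sub>1\<close>, and every
  element of \<open>A\<^sub>t\<^sub>+\<^sub>1\<close> has a neighbour in \<open>A\<^sub>t\<close>. Choosing such neighbours turns an increasing
  chain in \<open>A\<^sub>t\<^sub>+\<^sub>1\<close> whose parities alternate into one in \<open>A\<^sub>t\<close>. A left-to-right maximum
  that moves \<open>m\<close> places to the right at step \<open>t\<close> jumps over \<open>m\<close> consecutive descents, which
  lengthen the chain by \<open>m - 1\<close>. Hence after \<open>T\<close> steps its displacement is at most \<open>T\<close> plus the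
  length of an alternating chain in \<open>A\<^sub>0\<close>. Two consecutive members of such a chain enclose a
  monotone consecutive triple of the original permutation, and on average there are at most
  \<open>n / 3\<close> of those. The maximum of the first \<open>k\<close> entries has expected displacement at least
  \<open>n - n / (k + 1) - k\<close>, so the average sorting time is at least \<open>(2 / 3 - 1 / (k + 1)) n - k - 1\<close>.
\<close>

section \<open>Descents and the action of \<open>Pop\<close> on positions\<close>

definition descents :: "'a::linorder list \<Rightarrow> nat set" where
  "descents xs = {j. Suc j < length xs \<and> xs ! Suc j < xs ! j}"

text \<open>No decreasing block crosses a cut that is not a descent, so the two lists of blocks
  together meet the conditions of \<open>desc_runs_unique\<close>.\<close>

lemma desc_runs_append_runs:
  assumes "us = [] \<or> vs = [] \<or> last us \<le> hd vs"
  shows "desc_runs (us @ vs) = desc_runs us @ desc_runs vs"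
proof (cases "us = [] \<or> vs = []")
  case False
  have "last (last (desc_runs us)) = last us"
    using False concat_desc_runs[of us] hd_hd_desc_runs[of us] desc_runs_nonempty[of _ us]
    by (metis append.right_neutral append_butlast_last_id concat.simps concat_append last_appendR last_in_set)
  then have "successively (\<lambda>r s. last r \<le> hd s) (desc_runs us @ desc_runs vs)"
    using False assms hd_hd_desc_runs[of vs] desc_runs_maximal[of us] desc_runs_maximal[of vs]
    by (simp add: successively_append_iff)
  then show ?thesis
    by (intro desc_runs_unique[symmetric])
      (auto simp: concat_desc_runs dest: desc_runs_nonempty desc_runs_decreasing)
qed auto

lemma Pop_append:
  assumes "us = [] \<or> vs = [] \<or> last us \<le> hd vs"
  shows "Pop (us @ vs) = Pop us @ Pop vs"
  using assms by (simp add: Pop_def desc_runs_append_runs)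

lemma Pop_decreasing:
  assumes "successively (>) r"
  shows "Pop r = rev r"
proof (cases "r = []")
  case False
  then show ?thesis
    using desc_runs_append[of r "[]"] assms by (simp add: Pop_def)
qed (simp add: Pop_def)

lemma mset_Pop [simp]: "mset (Pop xs) = mset xs"
proof -
  have "mset (concat (map rev rs)) = mset (concat rs)" for rs :: "'a list list"
    by (induction rs) auto
  then show ?thesis
    by (simp add: Pop_def concat_desc_runs)
qed

lemma length_Pop [simp]: "length (Pop xs) = length xs"
  using mset_Pop by (rule mset_eq_length)

text \<open>The positional arguments below use \<open>Pop\<close> only in this form. The block fills
  the positions l to h, so its descents are l to h - 1; the last two hypotheses make it maximal, and
  reversal reflects i within it.\<close>

lemma nth_Pop:
  assumes lh: "l \<le> i" "i \<le> h" "h < length xs"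
    and run: "{l..<h} \<subseteq> descents xs"
    and left: "l = 0 \<or> l - 1 \<notin> descents xs"
    and right: "h \<notin> descents xs"
  shows "Pop xs ! i = xs ! (l + h - i)"
proof -
  define u where "u = take l xs"
  define r where "r = take (Suc h - l) (drop l xs)"
  define v where "v = drop (Suc h) xs"
  have len: "length u = l" "length r = Suc h - l"
    using lh by (auto simp: u_def r_def)
  have r_nth: "r ! j = xs ! (l + j)" if "j < Suc h - l" for j
    using that lh by (simp add: r_def)
  have "v = drop (Suc h - l) (drop l xs)"
    using lh by (simp add: v_def)
  then have "r @ v = drop l xs"
    unfolding r_def by (simp only: append_take_drop_id)
  then have xs: "xs = u @ r @ v"
    by (simp add: u_def)
  have r_ne: "r \<noteq> []"
    using len lh by auto
  have "successively (>) r"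
    unfolding successively_conv_nth
  proof (intro allI impI)
    fix j assume j: "Suc j < length r"
    then have "l + j \<in> descents xs"
      using run len by auto
    then show "r ! j > r ! Suc j"
      using j len by (simp add: r_nth descents_def)
  qed
  then have "Pop r = rev r"
    by (rule Pop_decreasing)
  moreover have "r = [] \<or> v = [] \<or> last r \<le> hd v"
  proof (cases "Suc h < length xs")
    case True
    then have "hd v = xs ! Suc h"
      by (simp add: v_def hd_drop_conv_nth)
    moreover have "last r = xs ! h"
      using r_ne len lh by (simp add: last_conv_nth r_nth)
    ultimately show ?thesis
      using right True by (auto simp: descents_def)
  qed (simp add: v_def)
  then have "Pop (r @ v) = Pop r @ Pop v"
    by (rule Pop_append)
  moreover have "u = [] \<or> r @ v = [] \<or> last u \<le> hd (r @ v)"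
  proof (cases "l = 0")
    case False
    have "last u = xs ! (l - 1)"
      using False len lh by (subst last_conv_nth) (auto simp: u_def)
    moreover have "hd (r @ v) = xs ! l"
      using r_ne lh by (simp add: hd_append hd_conv_nth r_nth)
    ultimately show ?thesis
      using left False lh by (auto simp: descents_def)
  qed (simp add: u_def)
  then have "Pop (u @ r @ v) = Pop u @ Pop (r @ v)"
    by (rule Pop_append)
  ultimately have "Pop xs = Pop u @ rev r @ Pop v"
    using xs by simp
  then have "Pop xs ! i = rev r ! (i - l)"
    using len lh by (simp add: nth_append less_diff_conv2 diff_less_mono)
  also have "\<dots> = xs ! (l + h - i)"
    using len lh by (simp add: rev_nth r_nth)
  finally show ?thesis .
qed

lemma run_right_end:
  assumes "i < length xs"
  obtains h where "i \<le> h" "h < length xs" "{i..<h} \<subseteq> descents xs" "h \<notin> descents xs"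
proof -
  let ?P = "\<lambda>h. i \<le> h \<and> h \<notin> descents xs"
  \<comment> \<open>The last position is never a descent, so the search to the right ends.\<close>
  have ex: "?P (length xs - 1)"
    using assms by (auto simp: descents_def)
  have least: "?P (Least ?P)"
    using ex by (rule LeastI[of ?P])
  have le: "Least ?P \<le> length xs - 1"
    using ex by (rule Least_le[of ?P])
  have "j \<in> descents xs" if "i \<le> j" "j < Least ?P" for j
    using not_less_Least[OF that(2)] that(1) by blast
  then have "{i..<Least ?P} \<subseteq> descents xs"
    by auto
  moreover have "Least ?P < length xs"
    using le assms by linarith
  ultimately show ?thesis
    using least by (intro that[of "Least ?P"]) simp_all
qed

lemma run_left_end:
  obtains l where "l \<le> i" "{l..<i} \<subseteq> descents xs" "l = 0 \<or> l - 1 \<notin> descents xs"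
proof -
  have "\<exists>l\<le>i. {l..<i} \<subseteq> descents xs \<and> (l = 0 \<or> l - 1 \<notin> descents xs)"
  proof (induction i)
    case (Suc i)
    show ?case
    proof (cases "i \<in> descents xs")
      case True
      moreover obtain l where "l \<le> i" "{l..<i} \<subseteq> descents xs" "l = 0 \<or> l - 1 \<notin> descents xs"
        using Suc by blast
      ultimately show ?thesis
        by (intro exI[of _ l]) (simp add: atLeastLessThanSuc)
    qed (auto intro!: exI[of _ "Suc i"])
  qed auto
  then show ?thesis
    using that by blast
qed

lemma decreasing_nth:
  assumes "{l..<h} \<subseteq> descents xs" "l \<le> i" "i \<le> j" "j \<le> h"
  shows "xs ! j \<le> xs ! i"
  using assms(3,4)
proof (induction rule: dec_induct)
  case (step j)
  then have "j \<in> descents xs"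
    using assms by auto
  then show ?case
    using step by (auto simp: descents_def)
qed simp

text \<open>The positions j and j + 1 lie in one block, and its reversal puts them in increasing
  order.\<close>

lemma descents_Pop_disjoint:
  assumes "j \<in> descents xs"
  shows "j \<notin> descents (Pop xs)"
proof -
  have j: "Suc j < length xs"
    using assms by (simp add: descents_def)
  obtain h where h: "Suc j \<le> h" "h < length xs" "{Suc j..<h} \<subseteq> descents xs" "h \<notin> descents xs"
    using run_right_end[OF j] .
  obtain l where l: "l \<le> j" "{l..<j} \<subseteq> descents xs" "l = 0 \<or> l - 1 \<notin> descents xs"
    using run_left_end .
  have "{l..<h} \<subseteq> {l..<j} \<union> {j} \<union> {Suc j..<h}"
    by auto
  then have lh: "{l..<h} \<subseteq> descents xs"
    using h l assms by blast
  have "Pop xs ! j = xs ! (l + h - j)" "Pop xs ! Suc j = xs ! (l + h - Suc j)"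
    using h l lh by (auto intro!: nth_Pop)
  moreover have "xs ! (l + h - j) \<le> xs ! (l + h - Suc j)"
    using h l by (intro decreasing_nth[OF lh]) auto
  ultimately show ?thesis
    by (auto simp: descents_def)
qed

text \<open>If none of j - 1, j, j + 1 is a descent, then j and j + 1 are blocks of length one, and
  \<open>Pop\<close> changes neither entry.\<close>

lemma descents_Pop_neighbour:
  assumes "j \<in> descents (Pop xs)"
  shows "(j > 0 \<and> j - 1 \<in> descents xs) \<or> Suc j \<in> descents xs"
proof (rule ccontr)
  assume *: "\<not> ?thesis"
  have "j \<notin> descents xs"
    using assms descents_Pop_disjoint by blast
  moreover have "Suc j < length xs"
    using assms by (simp add: descents_def)
  ultimately have "Pop xs ! j = xs ! j" "Pop xs ! Suc j = xs ! Suc j"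
    using * nth_Pop[of j j j xs] nth_Pop[of "Suc j" "Suc j" "Suc j" xs] by auto
  then show False
    using assms \<open>j \<notin> descents xs\<close> by (auto simp: descents_def)
qed

section \<open>Left-to-right maxima\<close>

definition left_max :: "'a::linorder list \<Rightarrow> nat \<Rightarrow> bool" where
  "left_max xs p \<longleftrightarrow> p < length xs \<and> (\<forall>i<p. xs ! i \<le> xs ! p)"

lemma left_max_not_descent:
  assumes "left_max xs p"
  shows "p = 0 \<or> p - 1 \<notin> descents xs"
  using assms by (auto simp: left_max_def descents_def not_less)

text \<open>A left-to-right maximum is the first entry of its block, so reversal carries it to the
  block's end h. Blocks further left stay to the left of p, hence no larger entry gets in front of
  it.\<close>

lemma left_max_Pop:
  assumes p: "left_max xs p"
    and h: "p \<le> h" "h < length xs" "{p..<h} \<subseteq> descents xs" "h \<notin> descents xs"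
  shows "Pop xs ! h = xs ! p" "left_max (Pop xs) h"
proof -
  have pop: "Pop xs ! i = xs ! (p + h - i)" if "p \<le> i" "i \<le> h" for i
    using left_max_not_descent[OF p] h that by (intro nth_Pop)
  show h_eq: "Pop xs ! h = xs ! p"
    using pop[of h] h by simp
  have "Pop xs ! i \<le> xs ! p" if i: "i < h" for i
  proof (cases "p \<le> i")
    case True
    then show ?thesis
      using pop[of i] i decreasing_nth[OF h(3), of p "p + h - i"] by auto
  next
    case False
    then have "i < length xs"
      using p by (auto simp: left_max_def)
    then obtain h' where h': "i \<le> h'" "h' < length xs" "{i..<h'} \<subseteq> descents xs" "h' \<notin> descents xs"
      by (rule run_right_end)
    obtain l where l: "l \<le> i" "{l..<i} \<subseteq> descents xs" "l = 0 \<or> l - 1 \<notin> descents xs"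
      using run_left_end .
    \<comment> \<open>A block reaching from i < p to p or beyond would have p - 1 as a
      descent.\<close>
    have "h' < p"
    proof (rule ccontr)
      assume "\<not> h' < p"
      then have "p - 1 \<in> {i..<h'}"
        using False by auto
      then show False
        using left_max_not_descent[OF p] h' False by auto
    qed
    moreover have "{l..<h'} \<subseteq> {l..<i} \<union> {i..<h'}"
      by auto
    then have "{l..<h'} \<subseteq> descents xs"
      using h' l by blast
    then have "Pop xs ! i = xs ! (l + h' - i)"
      using h' l by (intro nth_Pop) auto
    ultimately show ?thesis
      using p l by (auto simp: left_max_def)
  qed
  then show "left_max (Pop xs) h"
    using h h_eq by (simp add: left_max_def)
qed

section \<open>Alternating chains and the displacement of a maximum\<close>

definition alternating :: "nat set \<Rightarrow> nat list \<Rightarrow> bool" where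
  "alternating A c \<longleftrightarrow> set c \<subseteq> A \<and> successively (\<lambda>a b. a < b \<and> odd (b - a)) c"

text \<open>Moving every member by exactly one flips all parities, so gaps stay odd. The order could
  only break at a gap of 1 where a moves onto b or b onto a, and disjointness forbids that. Lower
  bounds drop by at most one.\<close>

lemma alternating_pull_back:
  assumes c: "alternating B c"
    and disj: "A \<inter> B = {}"
    and par: "\<And>b. b \<in> B \<Longrightarrow> (b > 0 \<and> b - 1 \<in> A) \<or> Suc b \<in> A"
  obtains c' where "alternating A c'" "length c' = length c"
    "\<And>q a. (\<forall>b\<in>set c. q \<le> b) \<Longrightarrow> a \<in> set c' \<Longrightarrow> q \<le> Suc a"
proof -
  define g where "g b = (if b > 0 \<and> b - 1 \<in> A then b - 1 else Suc b)" for b :: nat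
  have g: "g b \<in> A" "g b = Suc b \<or> Suc (g b) = b" if "b \<in> B" for b
    using par[OF that] by (auto simp: g_def)
  have mono: "g a < g b \<and> odd (g b - g a)" if "a \<in> B" "b \<in> B" "a < b" "odd (b - a)" for a b
  proof -
    have "g a \<noteq> b" "g b \<noteq> a"
      using g that disj by auto
    moreover have "b \<noteq> Suc (Suc a)"
      using that by auto
    ultimately have "g a < g b"
      using g(2)[OF that(1)] g(2)[OF that(2)] that(3) by linarith
    then show ?thesis
      using g(2)[OF that(1)] g(2)[OF that(2)] that(3,4) by auto presburger+
  qed
  have "successively (\<lambda>a b. g a < g b \<and> odd (g b - g a)) c"
    using c mono by (auto simp: alternating_def elim!: successively_mono)
  then have "alternating A (map g c)"
    using c g(1) by (auto simp: alternating_def successively_map)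
  moreover have "q \<le> Suc a" if "\<forall>b\<in>set c. q \<le> b" "a \<in> set (map g c)" for q a
    using that g(2) c unfolding alternating_def by fastforce
  ultimately show ?thesis
    using that[of "map g c"] by auto
qed

lemma alternating_upt:
  assumes "{p..<h} \<subseteq> A"
  shows "alternating A [p..<h]"
  using assms by (auto simp: alternating_def successively_conv_nth)

lemma alternating_extend:
  assumes c: "alternating A c" and ge: "\<forall>a\<in>set c. h \<le> Suc a" and ph: "{p..<h} \<subseteq> A" "p < h"
  obtains c' where "alternating A c'" "\<forall>a\<in>set c'. p \<le> a" "h + length c \<le> Suc (p + length c')"
proof (cases "c = []")
  case True
  then show ?thesis
    using that[of "[p..<h]"] alternating_upt ph by auto
next
  case False
  then obtain a d where ad: "c = a # d"
    by (cases c) auto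
  \<comment> \<open>The whole run is prepended if its last element h - 1 has the right parity.
    Otherwise, which includes a = h - 1, that element is omitted; this is the one unit lost in the
    length bound.\<close>
  define k where "k = (if odd (a - (h - 1)) then h else h - 1)"
  have a: "h - 1 \<le> a"
    using ge ad by auto
  have "alternating A ([p..<k] @ c)"
  proof -
    have "alternating A [p..<k]"
      using ph by (intro alternating_upt) (auto simp: k_def subset_iff)
    moreover have "last [p..<k] < a \<and> odd (a - last [p..<k])" if "p < k"
    proof -
      have last: "last [p..<k] = k - 1"
        using that by simp
      show ?thesis
      proof (cases "odd (a - (h - 1))")
        case True
        then have k: "k = h"
          unfolding k_def by (rule if_P)
        show ?thesis
          using odd_pos[OF True] True unfolding last unfolding k by linarith
      next
        case False
        then have k: "k = h - 1"
          unfolding k_def by (rule if_not_P)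
        have "a - (k - 1) = Suc (a - (h - 1))" "k - 1 < a"
          unfolding k using a that[unfolded k] by arith+
        then show ?thesis
          using False unfolding last by (metis even_Suc)
      qed
    qed
    ultimately show ?thesis
      using c unfolding alternating_def successively_append_iff ad by (cases "p < k") simp_all
  qed
  moreover have "p \<le> b" if "b \<in> set ([p..<k] @ c)" for b
  proof (cases "b \<in> set c")
    case True
    then have "h \<le> Suc b"
      using ge by blast
    then show ?thesis
      using ph by linarith
  qed (use that in simp)
  moreover have "h \<le> Suc k"
    unfolding k_def by (cases "odd (a - (h - 1))") auto
  then have "h + length c \<le> Suc (p + length ([p..<k] @ c))"
    by simp
  ultimately show ?thesis
    using that by blast
qed

text \<open>The induction peels off the first application of \<open>Pop\<close>, so the chain is
  built backwards in time. Keeping the chain at or right of p lets the run jumped over in the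
  current step be prepended; the unit lost there is paid for by the summand t.\<close>

lemma left_max_displacement:
  assumes "left_max xs p"
  shows "\<exists>q c. q < length xs \<and> (Pop ^^ t) xs ! q = xs ! p \<and> alternating (descents xs) c \<and>
    (\<forall>b\<in>set c. p \<le> b) \<and> q \<le> p + t + length c"
  using assms
proof (induction t arbitrary: xs p)
  case 0
  then show ?case
    by (intro exI[of _ p] exI[of _ "[]"]) (auto simp: left_max_def alternating_def)
next
  case (Suc t)
  have "p < length xs"
    using Suc.prems by (simp add: left_max_def)
  then obtain h where h: "p \<le> h" "h < length xs" "{p..<h} \<subseteq> descents xs" "h \<notin> descents xs"
    by (rule run_right_end)
  note pop = left_max_Pop[OF Suc.prems h]
  obtain q c where q: "q < length xs" "(Pop ^^ t) (Pop xs) ! q = xs ! p"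
    "alternating (descents (Pop xs)) c" "\<forall>b\<in>set c. h \<le> b" "q \<le> h + t + length c"
    using Suc.IH[OF pop(2)] pop(1) by auto
  have "descents xs \<inter> descents (Pop xs) = {}"
    using descents_Pop_disjoint by blast
  then obtain d where d: "alternating (descents xs) d" "length d = length c" "\<forall>a\<in>set d. h \<le> Suc a"
    using alternating_pull_back[OF q(3)] descents_Pop_neighbour q(4) by metis
  obtain c' where "alternating (descents xs) c'" "\<forall>a\<in>set c'. p \<le> a"
    "h + length c \<le> Suc (p + length c')"
  proof (cases "p < h")
    case True
    then show ?thesis
      using alternating_extend[OF d(1,3) h(3)] d(2) that by metis
  next
    case False
    \<comment> \<open>Here the maximum does not move and nothing is prepended. The pulled-back chain
      could start at p - 1, but p - 1 is not a descent.\<close>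
    have "p \<le> a" if "a \<in> set d" for a
    proof -
      have "p \<le> Suc a" "a \<in> descents xs"
        using that d False h by (auto simp: alternating_def)
      then show ?thesis
        using left_max_not_descent[OF Suc.prems] by (cases "p = Suc a") auto
    qed
    then show ?thesis
      using that[of d] d False h by auto
  qed
  then show ?case
    using q by (intro exI[of _ q] exI[of _ c']) (auto simp: funpow_swap1)
qed

section \<open>Chain length against monotone triples\<close>

definition mono_triples :: "'a::linorder list \<Rightarrow> nat set" where
  "mono_triples xs = {i. Suc (Suc i) < length xs \<and> (i \<in> descents xs \<longleftrightarrow> Suc i \<in> descents xs)}"

lemma finite_mono_triples [simp]: "finite (mono_triples xs)"
  by (rule finite_subset[of _ "{..<length xs}"]) (auto simp: mono_triples_def)

text \<open>Without a monotone triple, descents and non-descents alternate from a on, so b, at odd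
  distance from the descent a, could not be a descent.\<close>

lemma mono_triple_between:
  assumes "a < b" "odd (b - a)" "a \<in> descents xs" "b \<in> descents xs"
  obtains i where "a \<le> i" "i < b" "i \<in> mono_triples xs"
proof -
  have "\<exists>i. a \<le> i \<and> i < b \<and> i \<in> mono_triples xs"
  proof (rule ccontr)
    assume *: "\<not> ?thesis"
    have "j \<in> descents xs \<longleftrightarrow> even (j - a)" if "a \<le> j" "j \<le> b" for j
      using that
    proof (induction rule: dec_induct)
      case base
      then show ?case
        using assms by simp
    next
      case (step j)
      moreover have "Suc b < length xs"
        using assms by (simp add: descents_def)
      ultimately show ?case
        using * by (auto simp: mono_triples_def Suc_diff_le)
    qed
    then show False
      using assms by auto
  qed
  then show ?thesis
    using that by blast
qed

lemma length_alternating: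
  assumes "alternating (descents xs) c"
  shows "length c \<le> Suc (card (mono_triples xs))"
proof -
  \<comment> \<open>Counting only from the head of the chain makes the triple found between a and b
    new to the count from b on. For the empty chain \<open>hd\<close> is unspecified, but the left
    side is 0.\<close>
  have "length c \<le> Suc (card {i \<in> mono_triples xs. hd c \<le> i})"
    using assms
  proof (induction c rule: induct_list012)
    case (3 a b c)
    have ab: "a < b" "odd (b - a)" "a \<in> descents xs" "b \<in> descents xs"
      using "3.prems" by (auto simp: alternating_def)
    then obtain i where i: "a \<le> i" "i < b" "i \<in> mono_triples xs"
      by (rule mono_triple_between)
    have "Suc (card {i \<in> mono_triples xs. b \<le> i}) = card (insert i {i \<in> mono_triples xs. b \<le> i})"
      using i by (subst card_insert_disjoint) auto
    also have "\<dots> \<le> card {i \<in> mono_triples xs. a \<le> i}"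
      using i ab by (intro card_mono) auto
    finally show ?case
      using "3.IH"(2) "3.prems" by (auto simp: alternating_def)
  qed auto
  also have "\<dots> \<le> Suc (card (mono_triples xs))"
    by (auto intro!: card_mono)
  finally show ?thesis .
qed

section \<open>Iterating \<open>Pop\<close> sorts\<close>

lemma concat_rev_lex:
  fixes rs :: "nat list list"
  assumes "\<And>r. r \<in> set rs \<Longrightarrow> successively (>) r"
  shows "concat (map rev rs) = concat rs \<or> (concat (map rev rs), concat rs) \<in> lex less_than"
  using assms
proof (induction rs)
  case (Cons r rs)
  \<comment> \<open>\<open>lex\<close> relates only lists of equal length.\<close>
  have len: "length (concat (map rev rs)) = length (concat rs)"
    by (induction rs) auto
  consider "r = []" | a where "r = [a]" | a b s where "r = a # b # s"
    by (metis neq_Nil_conv)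
  then show ?case
  proof cases
    \<comment> \<open>A block of length at least two ends in an entry smaller than its first, so
      reversal lowers the first position and later blocks do not affect the comparison.\<close>
    case 3
    have "sorted_wrt (>) r"
      using Cons.prems by (subst successively_conv_sorted_wrt[symmetric]) (auto simp: transp_def)
    then have less: "last r < a"
      using 3 by auto
    obtain w where w: "rev r = last r # w"
      using 3 by (metis append_butlast_last_id list.distinct(1) rev.simps(2) rev_append rev_rev_ident append_Cons append_Nil rev_singleton_conv)
    have "length w = Suc (length s)"
      using arg_cong[OF w, of length] 3 by simp
    then show ?thesis
      using w 3 less len by simp
  qed (use Cons in auto)
qed simp

text \<open>A list fixed by \<open>Pop\<close> has a descent set disjoint from itself, so it is
  sorted; any other list strictly decreases in a well-founded order.\<close>

lemma Pop_sorts: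
  fixes xs :: "nat list"
  shows "\<exists>t. sorted ((Pop ^^ t) xs)"
proof (induction xs rule: wf_induct_rule[OF wf_lex[OF wf_less_than]])
  case (1 xs)
  have "Pop xs = xs \<or> (Pop xs, xs) \<in> lex less_than"
    using concat_rev_lex[of "desc_runs xs"] desc_runs_decreasing[of _ xs]
    by (simp add: Pop_def concat_desc_runs)
  then show ?case
  proof
    assume "Pop xs = xs"
    then have "descents xs = {}"
      using descents_Pop_disjoint[of _ xs] by auto
    have "xs ! i \<le> xs ! Suc i" if "Suc i < length xs" for i
    proof -
      have "i \<notin> descents xs"
        using \<open>descents xs = {}\<close> by blast
      then show ?thesis
        using that by (simp add: descents_def not_less)
    qed
    then have "sorted xs"
      by (simp add: sorted_iff_nth_Suc)
    then show ?thesis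
      by (intro exI[of _ 0]) simp
  next
    assume "(Pop xs, xs) \<in> lex less_than"
    then obtain t where "sorted ((Pop ^^ t) (Pop xs))"
      using 1 by blast
    then show ?thesis
      by (intro exI[of _ "Suc t"]) (simp add: funpow_swap1)
  qed
qed

text \<open>The \<open>LEAST\<close> in \<open>pop_iterations\<close> is meaningful only once some
  number of steps is known to sort, which \<open>Pop_sorts\<close> supplies.\<close>

lemma Pop_pop_iterations:
  assumes "\<sigma> \<in> permutations_of_set {1..n}"
  shows "(Pop ^^ pop_iterations \<sigma>) \<sigma> = [1..<Suc n]"
proof -
  have len: "length \<sigma> = n"
    using assms by (auto dest: length_finite_permutations_of_set)
  obtain t where t: "sorted ((Pop ^^ t) \<sigma>)"
    using Pop_sorts by blast
  have "mset ((Pop ^^ t) \<sigma>) = mset \<sigma>"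
    by (induction t) auto
  then have "set ((Pop ^^ t) \<sigma>) = {1..n}" "distinct ((Pop ^^ t) \<sigma>)"
    using assms by (metis mset_eq_setD permutations_of_setD(1),
      metis mset_eq_imp_distinct_iff permutations_of_setD(2))
  moreover have "set [1..<Suc n] = {1..n}"
    by auto
  ultimately have "(Pop ^^ t) \<sigma> = [1..<Suc n]"
    using t by (intro sorted_distinct_set_unique) (simp_all del: upt_Suc)
  then have "(Pop ^^ t) \<sigma> = [1..<Suc (length \<sigma>)]"
    using len by simp
  then show ?thesis
    using LeastI[of "\<lambda>t. (Pop ^^ t) \<sigma> = [1..<Suc (length \<sigma>)]" t] len
    by (simp add: pop_iterations_def)
qed

section \<open>The bound for a single permutation\<close>

definition exceed_prefix :: "nat \<Rightarrow> 'a::linorder list \<Rightarrow> nat set" where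
  "exceed_prefix k xs = {j. j < length xs \<and> (\<forall>i<k. xs ! i < xs ! j)}"

text \<open>The maximum M of the first k entries sits at some p < k and has to reach its sorted
  place, so \<open>left_max_displacement\<close> applies. The entries above M number n - M, and
  their positions form \<open>exceed_prefix\<close>.\<close>

lemma pop_iterations_lower_bound:
  assumes \<sigma>: "\<sigma> \<in> permutations_of_set {1..n}" and k: "0 < k" "k \<le> n"
  shows "n \<le> pop_iterations \<sigma> + card (mono_triples \<sigma>) + card (exceed_prefix k \<sigma>) + Suc k"
proof -
  have len: "length \<sigma> = n" and set: "set \<sigma> = {1..n}"
    using \<sigma> by (auto dest: length_finite_permutations_of_set permutations_of_setD)
  define M where "M = Max ((!) \<sigma> ` {..<k})"
  have "M \<in> (!) \<sigma> ` {..<k}"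
    unfolding M_def using k by (intro Max_in) auto
  then obtain p where p: "p < k" "\<sigma> ! p = M"
    by auto
  have M: "\<sigma> ! i \<le> M" if "i < k" for i
    unfolding M_def using that by (intro Max_ge) auto
  have "left_max \<sigma> p"
    using p k len M by (auto simp: left_max_def)
  then obtain q c where q: "q < n" "[1..<Suc n] ! q = M" "alternating (descents \<sigma>) c"
    "q \<le> p + pop_iterations \<sigma> + length c"
    using left_max_displacement[of \<sigma> p "pop_iterations \<sigma>"] Pop_pop_iterations[OF \<sigma>] len p(2) by auto
  \<comment> \<open>Positions count from 0 and values from 1.\<close>
  have "Suc q = M"
    using q(1,2) by (simp del: upt_Suc)
  moreover have "length c \<le> Suc (card (mono_triples \<sigma>))"
    using q(3) by (rule length_alternating)
  moreover have "n - M \<le> card (exceed_prefix k \<sigma>)"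
  proof -
    have "{M<..n} \<subseteq> (!) \<sigma> ` exceed_prefix k \<sigma>"
    proof
      fix v assume v: "v \<in> {M<..n}"
      then have "v \<in> set \<sigma>"
        using set by auto
      then obtain j where "j < n" "\<sigma> ! j = v"
        using len by (auto simp: in_set_conv_nth)
      then show "v \<in> (!) \<sigma> ` exceed_prefix k \<sigma>"
        using v M len by (fastforce simp: exceed_prefix_def)
    qed
    moreover have fin: "finite (exceed_prefix k \<sigma>)"
      by (rule finite_subset[of _ "{..<n}"]) (auto simp: exceed_prefix_def len)
    ultimately have "card {M<..n} \<le> card (exceed_prefix k \<sigma>)"
      using surj_card_le by blast
    then show ?thesis
      by simp
  qed
  ultimately show ?thesis
    using q(4) p(1) by linarith
qed

section \<open>Counting by exchanging entries\<close>

definition swap_entries :: "nat \<Rightarrow> nat \<Rightarrow> 'a list \<Rightarrow> 'a list" where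
  "swap_entries i j xs = xs[i := xs ! j, j := xs ! i]"

lemma swap_entries_permutation:
  assumes "xs \<in> permutations_of_set A" "i < length xs" "j < length xs"
  shows "swap_entries i j xs \<in> permutations_of_set A"
  using assms by (auto simp: permutations_of_set_def swap_entries_def)

lemma nth_swap_entries:
  assumes "i < length xs" "j < length xs" "l < length xs"
  shows "swap_entries i j xs ! l = xs ! (transpose i j l)"
  using assms by (auto simp: swap_entries_def nth_list_update transpose_def)

lemma swap_entries_involutory:
  assumes "i < length xs" "j < length xs"
  shows "swap_entries i j (swap_entries i j xs) = xs"
  using assms by (auto simp: swap_entries_def list_eq_iff_nth_eq nth_list_update)

text \<open>Swapping the entries at i and s injects the permutations with property \<open>Q\<close>
  at s into those with \<open>Q\<close> at i. By uniqueness these sets are disjoint for distinct i,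
  so \<open>Q\<close> at s has probability at most 1 / \<open>card S\<close>.\<close>

lemma card_exchangeable:
  fixes A :: "'a set"
  defines "P \<equiv> permutations_of_set A"
  assumes A: "finite A" and S: "finite S" "S \<subseteq> {..<card A}" "s \<in> S"
    and swap: "\<And>xs i. xs \<in> P \<Longrightarrow> i \<in> S \<Longrightarrow> Q xs s \<Longrightarrow> Q (swap_entries i s xs) i"
    and unique: "\<And>xs i j. xs \<in> P \<Longrightarrow> i \<in> S \<Longrightarrow> j \<in> S \<Longrightarrow> Q xs i \<Longrightarrow> Q xs j \<Longrightarrow> i = j"
  shows "card S * card {xs \<in> P. Q xs s} \<le> fact (card A)"
proof -
  have fin: "finite P"
    by (simp add: P_def)
  have len: "length xs = card A" if "xs \<in> P" for xs
    using that by (simp add: P_def length_finite_permutations_of_set)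
  have le: "card {xs \<in> P. Q xs s} \<le> card {xs \<in> P. Q xs i}" if i: "i \<in> S" for i
  proof (rule card_inj_on_le[of "swap_entries i s"])
    have "i < card A" "s < card A"
      using S i by auto
    then show "inj_on (swap_entries i s) {xs \<in> P. Q xs s}"
      by (intro inj_on_inverseI[of _ "swap_entries i s"]) (auto simp: swap_entries_involutory len)
    show "swap_entries i s ` {xs \<in> P. Q xs s} \<subseteq> {xs \<in> P. Q xs i}"
      using \<open>i < card A\<close> \<open>s < card A\<close> swap i len
      by (auto simp: P_def intro!: swap_entries_permutation)
  qed (use fin in auto)
  have "card S * card {xs \<in> P. Q xs s} = (\<Sum>i\<in>S. card {xs \<in> P. Q xs s})"
    by simp
  also have "\<dots> \<le> (\<Sum>i\<in>S. card {xs \<in> P. Q xs i})"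
    using le by (rule sum_mono)
  also have "\<dots> = card (\<Union>i\<in>S. {xs \<in> P. Q xs i})"
    using S fin unique by (intro card_UN_disjoint[symmetric]) auto
  also have "\<dots> \<le> card P"
    using fin by (intro card_mono) auto
  finally show ?thesis
    using A by (simp add: P_def)
qed

text \<open>In a monotone triple the median is in the middle, and only one of the three positions
  can hold the median; \<open>Q\<close> expresses holding it.\<close>

lemma card_mono_triple_le:
  assumes "Suc (Suc i) < n"
  shows "3 * card {\<sigma> \<in> permutations_of_set {1..n}. i \<in> mono_triples \<sigma>} \<le> fact n"
proof -
  define S where "S = {i, Suc i, Suc (Suc i)}"
  define Q where "Q \<sigma> m \<longleftrightarrow> (\<exists>a\<in>S. \<exists>b\<in>S. \<sigma> ! a < \<sigma> ! m \<and> \<sigma> ! m < \<sigma> ! b)"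
    for \<sigma> :: "nat list" and m
  have len: "length \<sigma> = n" and dist: "distinct \<sigma>" if "\<sigma> \<in> permutations_of_set {1..n}" for \<sigma>
    using that by (auto dest: length_finite_permutations_of_set permutations_of_setD)
  have "{\<sigma> \<in> permutations_of_set {1..n}. i \<in> mono_triples \<sigma>}
      \<subseteq> {\<sigma> \<in> permutations_of_set {1..n}. Q \<sigma> (Suc i)}"
  proof safe
    fix \<sigma> assume \<sigma>: "\<sigma> \<in> permutations_of_set {1..n}" "i \<in> mono_triples \<sigma>"
    have "\<sigma> ! i \<noteq> \<sigma> ! Suc i" "\<sigma> ! Suc i \<noteq> \<sigma> ! Suc (Suc i)"
      using \<sigma> assms len dist by (simp_all add: nth_eq_iff_index_eq)
    then show "Q \<sigma> (Suc i)"
      using \<sigma>(2) by (auto simp: Q_def S_def mono_triples_def descents_def)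
  qed
  then have "3 * card {\<sigma> \<in> permutations_of_set {1..n}. i \<in> mono_triples \<sigma>}
      \<le> card S * card {\<sigma> \<in> permutations_of_set {1..n}. Q \<sigma> (Suc i)}"
    by (intro mult_mono card_mono) (auto simp: S_def)
  also have "\<dots> \<le> fact (card {1..n})"
  proof (rule card_exchangeable)
    fix \<sigma> m assume \<sigma>: "\<sigma> \<in> permutations_of_set {1..n}" "m \<in> S" "Q \<sigma> (Suc i)"
    then obtain a b where ab: "a \<in> S" "b \<in> S" "\<sigma> ! a < \<sigma> ! Suc i" "\<sigma> ! Suc i < \<sigma> ! b"
      by (auto simp: Q_def)
    let ?t = "transpose m (Suc i)"
    have S: "Suc i \<in> S" "l < n" "?t l \<in> S" if "l \<in> S" for l
      using that \<sigma>(2) assms by (auto simp: S_def transpose_def)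
    have "swap_entries m (Suc i) \<sigma> ! l = \<sigma> ! (?t l)" if "l \<in> S" for l
      using that S \<sigma> len[OF \<sigma>(1)] by (intro nth_swap_entries) auto
    then show "Q (swap_entries m (Suc i) \<sigma>) m"
      unfolding Q_def using ab \<sigma>(2) S
      by (intro bexI[of _ "?t a"] bexI[of _ "?t b"]) auto
  next
    fix \<sigma> a b assume "\<sigma> \<in> permutations_of_set {1..n}" "a \<in> S" "b \<in> S" "Q \<sigma> a" "Q \<sigma> b"
    then show "a = b"
      by (auto simp: Q_def S_def)
  qed (use assms in \<open>auto simp: S_def\<close>)
  finally show ?thesis
    by simp
qed

text \<open>Such a j holds the maximum among the k + 1 positions consisting of j and the prefix;
  \<open>Q\<close> expresses holding this maximum. If j lies in the prefix, it would have to exceed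
  itself.\<close>

lemma card_exceed_prefix_le:
  assumes "j < n"
  shows "Suc k * card {\<sigma> \<in> permutations_of_set {1..n}. j \<in> exceed_prefix k \<sigma>} \<le> fact n"
proof (cases "k \<le> j")
  case False
  then have "{\<sigma> \<in> permutations_of_set {1..n}. j \<in> exceed_prefix k \<sigma>} = {}"
    by (auto simp: exceed_prefix_def intro!: exI[of _ j])
  then show ?thesis
    by (simp only: card.empty)
next
  case True
  define S where "S = insert j {..<k}"
  define Q where "Q \<sigma> m \<longleftrightarrow> (\<forall>a\<in>S. a \<noteq> m \<longrightarrow> \<sigma> ! a < \<sigma> ! m)" for \<sigma> :: "nat list" and m
  have len: "length \<sigma> = n" if "\<sigma> \<in> permutations_of_set {1..n}" for \<sigma>
    using that by (auto dest: length_finite_permutations_of_set)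
  have "{\<sigma> \<in> permutations_of_set {1..n}. j \<in> exceed_prefix k \<sigma>}
      \<subseteq> {\<sigma> \<in> permutations_of_set {1..n}. Q \<sigma> j}"
    by (auto simp: Q_def S_def exceed_prefix_def)
  then have "Suc k * card {\<sigma> \<in> permutations_of_set {1..n}. j \<in> exceed_prefix k \<sigma>}
      \<le> card S * card {\<sigma> \<in> permutations_of_set {1..n}. Q \<sigma> j}"
    using True by (intro mult_mono card_mono) (auto simp: S_def)
  also have "\<dots> \<le> fact (card {1..n})"
  proof (rule card_exchangeable)
    fix \<sigma> m assume \<sigma>: "\<sigma> \<in> permutations_of_set {1..n}" "m \<in> S" "Q \<sigma> j"
    let ?t = "transpose m j"
    have S: "j \<in> S" "l < n" "?t l \<in> S" if "l \<in> S" for l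
      using that \<sigma>(2) assms True by (auto simp: S_def transpose_def)
    have "swap_entries m j \<sigma> ! l = \<sigma> ! (?t l)" if "l \<in> S" for l
      using that S \<sigma> len[OF \<sigma>(1)] by (intro nth_swap_entries) auto
    moreover have "?t a \<noteq> j" if "a \<noteq> m" for a
      using that by (auto simp: transpose_def)
    ultimately show "Q (swap_entries m j \<sigma>) m"
      using \<sigma> S by (auto simp: Q_def)
  next
    fix \<sigma> a b assume "\<sigma> \<in> permutations_of_set {1..n}" "a \<in> S" "b \<in> S" "Q \<sigma> a" "Q \<sigma> b"
    then show "a = b"
      unfolding Q_def by (metis less_asym)
  qed (use assms True in \<open>auto simp: S_def\<close>)
  finally show ?thesis
    by simp
qed

section \<open>Averaging over all permutations\<close>

text \<open>Double counting of the pairs (x, i) with i in \<open>F x\<close>: linearity of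
  expectation in integer form.\<close>

lemma sum_card_le:
  fixes P :: "'a set" and F :: "'a \<Rightarrow> nat set"
  assumes "finite P" "\<And>x. x \<in> P \<Longrightarrow> F x \<subseteq> {..<n}"
    and "\<And>i. i < n \<Longrightarrow> d * card {x \<in> P. i \<in> F x} \<le> N"
  shows "d * (\<Sum>x\<in>P. card (F x)) \<le> n * N"
proof -
  have "card (F x) = (\<Sum>i<n. of_bool (i \<in> F x))" if "x \<in> P" for x
  proof -
    have "F x = {i \<in> {..<n}. i \<in> F x}"
      using assms(2)[OF that] by auto
    then show ?thesis
      by (simp add: sum_of_bool_eq Int_def conj_commute)
  qed
  then have "(\<Sum>x\<in>P. card (F x)) = (\<Sum>x\<in>P. \<Sum>i<n. of_bool (i \<in> F x))"
    by (rule sum.cong[OF refl])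
  also have "\<dots> = (\<Sum>i<n. \<Sum>x\<in>P. of_bool (i \<in> F x))"
    by (rule sum.swap)
  also have "\<dots> = (\<Sum>i<n. card {x \<in> P. i \<in> F x})"
    using assms(1) by (simp add: sum_of_bool_eq Int_def)
  finally have "d * (\<Sum>x\<in>P. card (F x)) = (\<Sum>i<n. d * card {x \<in> P. i \<in> F x})"
    by (simp add: sum_distrib_left)
  also have "\<dots> \<le> (\<Sum>i<n. N)"
    using assms(3) by (intro sum_mono) auto
  finally show ?thesis
    by simp
qed

lemma D_Pop_lower_bound:
  assumes k: "0 < k" "k \<le> n"
  shows "real n \<le> D_Pop n + real n / 3 + real n / real (Suc k) + real (Suc k)"
proof -
  define P where "P = permutations_of_set {1..n}"
  define T where "T = (\<Sum>\<sigma>\<in>P. pop_iterations \<sigma>)"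
  define G where "G = (\<Sum>\<sigma>\<in>P. card (mono_triples \<sigma>))"
  define H where "H = (\<Sum>\<sigma>\<in>P. card (exceed_prefix k \<sigma>))"
  have fin: "finite P" and card: "card P = fact n"
    by (simp_all add: P_def)
  have len: "length \<sigma> = n" if "\<sigma> \<in> P" for \<sigma>
    using that by (auto simp: P_def dest: length_finite_permutations_of_set)
  have "3 * G \<le> n * fact n"
    unfolding G_def
  proof (rule sum_card_le[OF fin])
    show "mono_triples \<sigma> \<subseteq> {..<n}" if "\<sigma> \<in> P" for \<sigma>
      using len[OF that] by (auto simp: mono_triples_def)
    show "3 * card {\<sigma> \<in> P. i \<in> mono_triples \<sigma>} \<le> fact n" for i
    proof (cases "Suc (Suc i) < n")
      case True
      then show ?thesis
        unfolding P_def by (rule card_mono_triple_le)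
    next
      case False
      then have "{\<sigma> \<in> P. i \<in> mono_triples \<sigma>} = {}"
        using len by (auto simp: mono_triples_def)
      then show ?thesis
        by (simp only: card.empty)
    qed
  qed
  then have "real (3 * G) \<le> real (n * fact n)"
    by (rule of_nat_mono)
  then have G: "real G \<le> real n / 3 * fact n"
    by simp
  have "Suc k * H \<le> n * fact n"
    unfolding H_def
  proof (rule sum_card_le[OF fin])
    show "exceed_prefix k \<sigma> \<subseteq> {..<n}" if "\<sigma> \<in> P" for \<sigma>
      using len[OF that] by (auto simp: exceed_prefix_def)
    show "Suc k * card {\<sigma> \<in> P. i \<in> exceed_prefix k \<sigma>} \<le> fact n" if "i < n" for i
      unfolding P_def using that by (rule card_exceed_prefix_le)
  qed
  then have "real (Suc k * H) \<le> real (n * fact n)"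
    by (rule of_nat_mono)
  then have "real (Suc k) * real H \<le> real n * fact n"
    by (simp only: of_nat_mult of_nat_fact)
  then have H: "real H \<le> real n / real (Suc k) * fact n"
    by (simp add: field_simps del: of_nat_Suc)
  \<comment> \<open>The pointwise bound is summed over all n! permutations; the factor
    \<open>fact n\<close> is cancelled at the end.\<close>
  have "(\<Sum>\<sigma>\<in>P. n) \<le> (\<Sum>\<sigma>\<in>P. pop_iterations \<sigma> + card (mono_triples \<sigma>)
      + card (exceed_prefix k \<sigma>) + Suc k)"
    unfolding P_def using k by (intro sum_mono pop_iterations_lower_bound)
  then have "fact n * n \<le> T + G + H + fact n * Suc k"
    by (simp only: sum.distrib sum_constant card T_def G_def H_def of_nat_id)
  then have "real (fact n * n) \<le> real (T + G + H + fact n * Suc k)"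
    by (rule of_nat_mono)
  moreover have "real T = D_Pop n * fact n"
    by (simp add: T_def P_def D_Pop_def)
  ultimately have "real n * fact n
      \<le> (D_Pop n + real n / 3 + real n / real (Suc k) + real (Suc k)) * fact n"
    using G H unfolding of_nat_add of_nat_mult of_nat_fact
    by (simp add: algebra_simps del: of_nat_Suc)
  then show ?thesis
    by (subst (asm) mult_le_cancel_right_pos) auto
qed

theorem theorem1:
  shows "liminf (\<lambda>n. ereal (D_Pop n / real n)) \<ge> ereal (3 / 5)"
proof (rule Liminf_bounded)
  \<comment> \<open>With k = 29 the average is at least (2/3 - 1/30) n - 30 = (3/5) n + n/30 - 30,
    and n/30 covers the 30 once n is at least 900.\<close>
  have "3 / 5 \<le> D_Pop n / real n" if "n \<ge> 900" for n
    using D_Pop_lower_bound[of 29 n] that by (simp add: field_simps)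
  then show "\<forall>\<^sub>F n in sequentially. ereal (3 / 5) \<le> ereal (D_Pop n / real n)"
    by (auto intro!: eventually_sequentiallyI[of 900])
qed

end
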